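(* Let $m,N$ be positive integers. The subspace $\operatorname{span}(\{\mu_\pi\}_{\pi\in\Pi(m)})\subset\mathbb{R}^{\mathcal{P}(\mathbb{R}^m)}$ is closed under the action of the resampling operator $\mathcal{S}$, and on this subspace $\mathcal{S}$ takes the form $$\mathcal{S}\mu_\sigma=\sum_{\pi\ge\sigma}\frac{\#\mathbb{I}^{=}_N(\pi)}{\#\mathbb{I}^{\ge}_N(\sigma)}\,\mu_\pi\qquad\text{for all }\sigma\in\Pi(m).$$ In particular, the action of $\mathcal{S}$ on the moment polynomials $\sum_{\pi\in\Pi(m)}f_\pi\mu_\pi$ is represented by multiplying the coefficient vector $f\in\mathbb{R}^{\Pi(m)}$ with the matrix $S\in\mathbb{R}^{\Pi(m)\times\Pi(m)}$ defined by $$S_{\pi,\sigma}=\begin{cases}\dfrac{\#\mathbb{I}^{=}_N(\pi)}{\#\mathbb{I}^{\ge}_N(\sigma)}&\text{if }\sigma\le\pi,\\[2mm]0&\text{else,}\end{cases}$$ that is, $\mathcal{S}\big(\sum_\pi f_\pi\mu_\pi\big)=\sum_\pi (Sf)_\pi\mu_\pi$.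
   Context: $\mathcal{P}(\mathbb{R}^m)$ is the set of probability measures on $\mathbb{R}^m$ with finite moments of all orders. For $X\in\mathcal{P}(\mathbb{R}^m)$, $Y\sim_N X$ denotes a random $N\times m$ matrix whose $N$ rows are independent samples from $X$; $Y$ is identified with the empirical distribution of its rows, a (random) element of $\mathcal{P}(\mathbb{R}^m)$. The resampling operator acts on functionals $F:\mathcal{P}(\mathbb{R}^m)\to\mathbb{R}$ (for which the expectation exists) by $(\mathcal{S}F)(X)=\mathbb{E}_{Y\sim_N X}[F(Y)]$. $\Pi(m)$ is the set of partitions of $\{1,\dots,m\}$, partially ordered by $\pi\le\sigma$ iff $\pi$ is a sub-partition (refinement) of $\sigma$; $\#\pi$ is the number of parts of $\pi$. For $p\subset\{1,\dots,m\}$, $\mu_p(X)=\mathbb{E}_{x\sim X}[\prod_{i\in p}x_i]$, and for $\pi\in\Pi(m)$, $\mu_\pi(X)=\prod_{p\in\pi}\mu_p(X)$. For a multiindex $\mathbf{i}\in\{1,\dots,N\}^m$, $\varsigma(\mathbf{i})\in\Pi(m)$ is the partition in which $k,l$ lie in the same part iff $i_k=i_l$. Put $\mathbb{I}^{\ge}_N(\pi)=\{\mathbf{i}\in\{1,\dots,N\}^m:\varsigma(\mathbf{i})\ge\pi\}$ and $\mathbb{I}^{=}_N(\pi)=\{\mathbf{i}\in\{1,\dots,N\}^m:\varsigma(\mathbf{i})=\pi\}$; $\#$ denotes cardinality. (Thus $\#\mathbb{I}^{\ge}_N(\pi)=N^{\#\pi}$ and $\#\mathbb{I}^{=}_N(\pi)=N!/(N-\#\pi)!$,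 which is $0$ if $N<\#\pi$.) *)

theory Defs
  imports "HOL-Probability.Probability" "HOL-Library.Function_Algebras" "HOL-Library.Disjoint_Sets"
begin

text \<open>
  The index set \<open>{1, \<dots>, m}\<close> is rendered as a finite type \<open>'m\<close>, so \<open>m = CARD('m)\<close>.
  Functionals form the vector space of all real functions on the type of distributions,
  with pointwise operations.
\<close>

instantiation "fun" :: (type, real_vector) real_vector
begin

definition scaleR_fun :: "real \<Rightarrow> ('a \<Rightarrow> 'b) \<Rightarrow> 'a \<Rightarrow> 'b"
  where "scaleR_fun c f = (\<lambda>x. c *\<^sub>R f x)"

instance
  by standard (auto simp: scaleR_fun_def fun_eq_iff scaleR_add_right scaleR_add_left)

end

typedef (overloaded) ('m::finite) moment_dist =
  "{X :: (real ^ 'm) measure. prob_space X \<and> sets X = sets borel \<and>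
      (\<forall>k::nat. integrable X (\<lambda>x. norm x ^ k))}"
  morphisms measure_of_dist Abs_moment_dist
proof
  have "integrable (return borel (0 :: real ^ 'm)) (\<lambda>x. norm x ^ k)" for k :: nat
    by (rule integrableI_bounded) (auto simp: nn_integral_return)
  then show "return borel (0 :: real ^ 'm) \<in> {X. prob_space X \<and> sets X = sets borel \<and>
      (\<forall>k::nat. integrable X (\<lambda>x. norm x ^ k))}"
    by (auto intro: prob_space_return)
qed

text \<open>A sample matrix \<open>Y\<close> is represented by its rows \<open>Y 1, \<dots>, Y N\<close>. For \<open>N = 0\<close> the value of
  \<open>empirical\<close> is unspecified.\<close>

definition empirical :: "nat \<Rightarrow> (nat \<Rightarrow> real ^ 'm) \<Rightarrow> ('m::finite) moment_dist"
  where "empirical N Y = Abs_moment_dist (distr (uniform_count_measure {1..N}) borel Y)"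

lemma measure_of_dist_empirical:
  fixes Y :: "nat \<Rightarrow> real ^ ('m::finite)"
  assumes "N \<ge> 1"
  shows "measure_of_dist (empirical N Y) = distr (uniform_count_measure {1..N}) borel Y"
proof -
  have Y: "Y \<in> measurable (uniform_count_measure {1..N}) borel"
    by (auto simp: measurable_def space_uniform_count_measure sets_uniform_count_measure)
  have "prob_space (uniform_count_measure {1..N})"
    using assms by (intro prob_space_uniform_count_measure) auto
  then have "prob_space (distr (uniform_count_measure {1..N}) borel Y)"
    using Y by (rule prob_space.prob_space_distr)
  moreover have "integrable (distr (uniform_count_measure {1..N}) borel Y) (\<lambda>x. norm x ^ k)" for k :: nat
    using Y by (subst integrable_distr_eq)
      (auto simp: uniform_count_measure_def intro!: integrable_point_measure_finite)
  ultimately show ?thesis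
    unfolding empirical_def by (intro Abs_moment_dist_inverse) auto
qed

definition sample_law :: "nat \<Rightarrow> ('m::finite) moment_dist \<Rightarrow> (nat \<Rightarrow> real ^ 'm) measure"
  where "sample_law N X = (\<Pi>\<^sub>M k\<in>{1..N}. measure_of_dist X)"

text \<open>The functionals for which the expectation defining the resampling operator exists; outside
  of this set the value of \<open>resample\<close> may involve the Bochner integral's default value \<open>0\<close>.\<close>

definition resample_domain :: "nat \<Rightarrow> (('m::finite) moment_dist \<Rightarrow> real) set"
  where "resample_domain N = {F. \<forall>X. integrable (sample_law N X) (\<lambda>Y. F (empirical N Y))}"

definition resample :: "nat \<Rightarrow> (('m::finite) moment_dist \<Rightarrow> real) \<Rightarrow> 'm moment_dist \<Rightarrow> real"
  where "resample N F X = (\<integral>Y. F (empirical N Y) \<partial>sample_law N X)"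

definition partitions :: "('m::finite) set set set"
  where "partitions = {\<pi>. partition_on UNIV \<pi>}"

definition mixed_moment :: "('m::finite) set \<Rightarrow> 'm moment_dist \<Rightarrow> real"
  where "mixed_moment p X = (\<integral>x. (\<Prod>i\<in>p. x $ i) \<partial>measure_of_dist X)"

definition moment_prod :: "('m::finite) set set \<Rightarrow> 'm moment_dist \<Rightarrow> real"
  where "moment_prod \<pi> X = (\<Prod>p\<in>\<pi>. mixed_moment p X)"

definition index_partition :: "(('m::finite) \<Rightarrow> nat) \<Rightarrow> 'm set set"
  where "index_partition i = UNIV // {(k, l). i k = i l}"

definition I_ge :: "nat \<Rightarrow> ('m::finite) set set \<Rightarrow> ('m \<Rightarrow> nat) set"
  where "I_ge N \<pi> = {i. range i \<subseteq> {1..N} \<and> refines UNIV \<pi> (index_partition i)}"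

definition I_eq :: "nat \<Rightarrow> ('m::finite) set set \<Rightarrow> ('m \<Rightarrow> nat) set"
  where "I_eq N \<pi> = {i. range i \<subseteq> {1..N} \<and> index_partition i = \<pi>}"

text \<open>Elements of \<open>\<real>\<^sup>\<Pi>\<close> and \<open>\<real>\<^sup>\<Pi>\<^sup>\<times>\<^sup>\<Pi>\<close>, with \<open>\<Pi>\<close> the set of partitions, are functions of which only the
  values at partitions matter.\<close>

definition resample_matrix :: "nat \<Rightarrow> ('m::finite) set set \<Rightarrow> 'm set set \<Rightarrow> real"
  where "resample_matrix N \<pi> \<sigma> =
    (if refines UNIV \<sigma> \<pi> then real (card (I_eq N \<pi>)) / real (card (I_ge N \<sigma>)) else 0)"

definition mat_vec :: "(('m::finite) set set \<Rightarrow> 'm set set \<Rightarrow> real) \<Rightarrow> ('m set set \<Rightarrow> real) \<Rightarrow> 'm set set \<Rightarrow> real"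
  where "mat_vec A f \<pi> = (\<Sum>\<sigma>\<in>partitions. A \<pi> \<sigma> * f \<sigma>)"

end

theory Submission
  imports Defs
begin

text \<open>
  Expanding the product over the parts of \<open>\<sigma>\<close> of the averages over the rows of \<open>Y\<close> writes
  \<open>\<mu>\<^sub>\<sigma>(Y)\<close> as the average, over the multiindices that are constant on the parts of \<open>\<sigma>\<close>, of the
  monomials \<open>\<Prod>k. Y (i k) k\<close>. As the rows are independent, the expectation of such a monomial
  factors over the level sets of \<open>i\<close> and equals \<open>\<mu>\<^sub>\<pi>(X)\<close>, with \<open>\<pi>\<close> the partition induced by \<open>i\<close>.
  Sorting the multiindices by \<open>\<pi>\<close> yields the formula.
\<close>

section \<open>Multiindices and the partitions that they induce\<close>

lemma partition_on_index_partition: "partition_on UNIV (index_partition i)"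
  unfolding index_partition_def
  by (rule partition_on_quotient) (auto simp: equiv_def refl_on_def sym_def trans_def)

text \<open>Only attained values occur: the fibre over any other value is empty and hence not a
  part.\<close>

lemma index_partition_eq_image:
  "index_partition i = (\<lambda>v. i -` {v}) ` range i"
proof -
  have "{(k, l). i k = i l} `` {k} = i -` {i k}" for k
    by auto
  then show ?thesis
    by (auto simp: index_partition_def quotient_def)
qed

text \<open>Parts of \<sigma> are nonempty, so such a part lies inside a level set of
  \<open>i\<close> exactly when \<open>i\<close> is constant on it.\<close>

lemma I_ge_iff:
  assumes "partition_on UNIV \<sigma>"
  shows "i \<in> I_ge N \<sigma> \<longleftrightarrow>
    range i \<subseteq> {1..N} \<and> (\<forall>p\<in>\<sigma>. \<forall>k\<in>p. \<forall>l\<in>p. i k = i l)"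
proof -
  have "(\<exists>q\<in>index_partition i. p \<subseteq> q) \<longleftrightarrow> (\<forall>k\<in>p. \<forall>l\<in>p. i k = i l)" if p: "p \<in> \<sigma>" for p
  proof -
    obtain k where k: "k \<in> p"
      using p partition_onD3[OF assms] by (metis ex_in_conv)
    have "(\<exists>q\<in>index_partition i. p \<subseteq> q) \<longleftrightarrow> (\<exists>v\<in>range i. \<forall>l\<in>p. i l = v)"
      unfolding index_partition_eq_image by auto
    also have "\<dots> \<longleftrightarrow> (\<forall>k\<in>p. \<forall>l\<in>p. i k = i l)"
      using k by (metis rangeI)
    finally show ?thesis .
  qed
  then show ?thesis
    using assms partition_on_index_partition[of i] by (auto simp: I_ge_def refines_def)
qed

lemma finite_I_ge: "finite (I_ge N (\<sigma> :: ('m::finite) set set))"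
proof (rule finite_subset)
  show "I_ge N \<sigma> \<subseteq> PiE UNIV (\<lambda>_. {1..N})"
    by (auto simp: I_ge_def PiE_UNIV_domain)
qed (auto intro: finite_PiE)

definition part_of :: "'a set set \<Rightarrow> 'a \<Rightarrow> 'a set"
  where "part_of \<sigma> k = (THE p. p \<in> \<sigma> \<and> k \<in> p)"

lemma part_of_eq:
  assumes "partition_on A \<sigma>" "p \<in> \<sigma>" "k \<in> p"
  shows "part_of \<sigma> k = p"
  unfolding part_of_def
  by (rule the_equality) (use assms in \<open>auto simp: partition_on_def disjoint_def\<close>)

lemma part_of_in:
  assumes "partition_on A \<sigma>" "k \<in> A"
  shows "part_of \<sigma> k \<in> \<sigma>" "k \<in> part_of \<sigma> k"
proof -
  obtain p where "p \<in> \<sigma>" "k \<in> p"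
    using assms by (auto simp: partition_on_def)
  with part_of_eq[OF assms(1) this] show "part_of \<sigma> k \<in> \<sigma>" "k \<in> part_of \<sigma> k"
    by auto
qed

text \<open>A multiindex that is constant on every part amounts to one choice of a row per part.
  Expanding a product of sums by \<open>prod_sum_PiE\<close> sums over such choices, and this
  bijection turns them into multiindices; it also yields the cardinality of
  \<open>I_ge N \<sigma>\<close>.\<close>

lemma bij_betw_PiE_I_ge:
  fixes \<sigma> :: "('m::finite) set set"
  assumes \<sigma>: "partition_on UNIV \<sigma>"
  shows "bij_betw (\<lambda>g k. g (part_of \<sigma> k)) (PiE \<sigma> (\<lambda>_. {1..N})) (I_ge N \<sigma>)"
\<comment> \<open>The inverse reads off the value of \<open>i\<close> at an arbitrary representative
  of each part; restricting to \<sigma> makes the result extensional, as \<open>PiE\<close>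
  demands.\<close>
proof (rule bij_betw_byWitness[where f' = "\<lambda>i. \<lambda>p\<in>\<sigma>. i (SOME k. k \<in> p)"])
  have some: "(SOME k. k \<in> p) \<in> p" if "p \<in> \<sigma>" for p
    using that \<sigma> by (auto simp: partition_on_def some_in_eq)
  note part = part_of_in[OF \<sigma>, simplified]
  show "\<forall>g\<in>PiE \<sigma> (\<lambda>_. {1..N}). (\<lambda>p\<in>\<sigma>. g (part_of \<sigma> (SOME k. k \<in> p))) = g"
    by (auto simp: fun_eq_iff part_of_eq[OF \<sigma> _ some] PiE_def extensional_def)
  show "\<forall>i\<in>I_ge N \<sigma>. (\<lambda>k. (\<lambda>p\<in>\<sigma>. i (SOME k. k \<in> p)) (part_of \<sigma> k)) = i"
  proof
    fix i assume "i \<in> I_ge N \<sigma>"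
    then have "i (SOME l. l \<in> part_of \<sigma> k) = i k" for k
      unfolding I_ge_iff[OF \<sigma>] using some[OF part(1)[of k]] part[of k] by blast
    then show "(\<lambda>k. (\<lambda>p\<in>\<sigma>. i (SOME k. k \<in> p)) (part_of \<sigma> k)) = i"
      using part(1) by simp
  qed
  show "(\<lambda>g k. g (part_of \<sigma> k)) ` PiE \<sigma> (\<lambda>_. {1..N}) \<subseteq> I_ge N \<sigma>"
  proof (clarsimp simp only: I_ge_iff[OF \<sigma>])
    fix g assume g: "g \<in> PiE \<sigma> (\<lambda>_. {1..N})"
    have "g (part_of \<sigma> k) \<in> {1..N}" for k
      using PiE_mem[OF g part(1)] .
    then show "range (\<lambda>k. g (part_of \<sigma> k)) \<subseteq> {1..N} \<and>
      (\<forall>p\<in>\<sigma>. \<forall>k\<in>p. \<forall>l\<in>p. g (part_of \<sigma> k) = g (part_of \<sigma> l))"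
      by (auto simp: part_of_eq[OF \<sigma>])
  qed
  show "(\<lambda>i. \<lambda>p\<in>\<sigma>. i (SOME k. k \<in> p)) ` I_ge N \<sigma> \<subseteq> PiE \<sigma> (\<lambda>_. {1..N})"
    unfolding I_ge_def by (rule image_subsetI, rule restrict_PiE_iff[THEN iffD2]) blast
qed

lemma card_I_ge:
  assumes "partition_on UNIV (\<sigma> :: ('m::finite) set set)"
  shows "card (I_ge N \<sigma>) = N ^ card \<sigma>"
  using bij_betw_same_card[OF bij_betw_PiE_I_ge[OF assms, of N]] by (simp add: card_PiE)

section \<open>Moments of the empirical distribution\<close>

lemma mixed_moment_empirical:
  assumes "N \<ge> 1"
  shows "mixed_moment p (empirical N Y) = (\<Sum>v\<in>{1..N}. \<Prod>k\<in>p. Y v $ k) / N"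
proof -
  have Y: "Y \<in> measurable (uniform_count_measure {1..N}) borel"
    by (auto simp: measurable_def space_uniform_count_measure sets_uniform_count_measure)
  have "mixed_moment p (empirical N Y)
    = (\<integral>v. (\<Prod>k\<in>p. Y v $ k) \<partial>uniform_count_measure {1..N})"
    unfolding mixed_moment_def measure_of_dist_empirical[OF assms]
    by (rule integral_distr[OF Y]) measurable
  also have "\<dots> = (\<Sum>v\<in>{1..N}. \<Prod>k\<in>p. Y v $ k) / N"
    by (simp add: uniform_count_measure_def lebesgue_integral_point_measure_finite sum_divide_distrib)
  finally show ?thesis .
qed

lemma moment_prod_empirical:
  fixes \<sigma> :: "('m::finite) set set"
  assumes N: "N \<ge> 1" and \<sigma>: "partition_on UNIV \<sigma>"
  shows "moment_prod \<sigma> (empirical N Y) =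
    (\<Sum>i\<in>I_ge N \<sigma>. \<Prod>k\<in>UNIV. Y (i k) $ k) / card (I_ge N \<sigma>)"
proof -
  \<comment> \<open>For a fixed choice \<open>g\<close> of rows, the disjoint parts cover all
    coordinates, so the double product meets each coordinate exactly once.\<close>
  have prod_parts: "(\<Prod>p\<in>\<sigma>. \<Prod>k\<in>p. Y (g p) $ k) = (\<Prod>k\<in>UNIV. Y (g (part_of \<sigma> k)) $ k)" for g
  proof -
    have "(\<Prod>k\<in>UNIV. Y (g (part_of \<sigma> k)) $ k) = (\<Prod>k\<in>\<Union>\<sigma>. Y (g (part_of \<sigma> k)) $ k)"
      using \<sigma> by (simp add: partition_on_def)
    also have "\<dots> = (\<Prod>p\<in>\<sigma>. \<Prod>k\<in>p. Y (g (part_of \<sigma> k)) $ k)"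
      using \<sigma> by (subst prod.Union_disjoint) (auto simp: partition_on_def disjoint_def)
    also have "\<dots> = (\<Prod>p\<in>\<sigma>. \<Prod>k\<in>p. Y (g p) $ k)"
      by (intro prod.cong refl) (simp add: part_of_eq[OF \<sigma>])
    finally show ?thesis ..
  qed
  have "moment_prod \<sigma> (empirical N Y) =
    (\<Prod>p\<in>\<sigma>. \<Sum>v\<in>{1..N}. \<Prod>k\<in>p. Y v $ k) / N ^ card \<sigma>"
    by (simp add: moment_prod_def mixed_moment_empirical[OF N] prod_dividef)
  \<comment> \<open>Distributivity: multiplying out the sums means choosing one row
    \<open>g p\<close> for each part \<open>p\<close>.\<close>
  also have "(\<Prod>p\<in>\<sigma>. \<Sum>v\<in>{1..N}. \<Prod>k\<in>p. Y v $ k) =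
    (\<Sum>g\<in>PiE \<sigma> (\<lambda>_. {1..N}). \<Prod>k\<in>UNIV. Y (g (part_of \<sigma> k)) $ k)"
    by (simp add: prod_sum_PiE prod_parts)
  also have "\<dots> = (\<Sum>i\<in>I_ge N \<sigma>. \<Prod>k\<in>UNIV. Y (i k) $ k)"
    by (rule sum.reindex_bij_betw[OF bij_betw_PiE_I_ge[OF \<sigma>],
          where g = "\<lambda>i. \<Prod>k\<in>UNIV. Y (i k) $ k"])
  finally show ?thesis
    by (simp add: card_I_ge[OF \<sigma>])
qed

section \<open>Expectations of monomials in the sample\<close>

lemma
  shows prob_space_measure_of_dist: "prob_space (measure_of_dist X)"
    and sets_measure_of_dist: "sets (measure_of_dist X) = sets borel"
    and integrable_norm_power: "integrable (measure_of_dist X) (\<lambda>x. norm x ^ n)"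
  using measure_of_dist[of X] by auto

text \<open>Each coordinate is bounded by the norm, so the monomial is dominated by a power of the
  norm, and all such powers are integrable.\<close>

lemma integrable_prod_components:
  "integrable (measure_of_dist X) (\<lambda>x. \<Prod>k\<in>p. x $ k)"
proof (rule Bochner_Integration.integrable_bound[OF integrable_norm_power[of X "card p"]])
  show "(\<lambda>x. \<Prod>k\<in>p. x $ k) \<in> borel_measurable (measure_of_dist X)"
    unfolding measurable_cong_sets[OF sets_measure_of_dist refl] by measurable
  have "\<bar>\<Prod>k\<in>p. x $ k\<bar> \<le> norm x ^ card p" for x :: "real ^ 'a"
    unfolding abs_prod using prod_mono[of p "\<lambda>k. \<bar>x $ k\<bar>" "\<lambda>_. norm x"]
    by (simp add: component_le_norm_cart)
  then show "AE x in measure_of_dist X. norm (\<Prod>k\<in>p. x $ k) \<le> norm (norm x ^ card p)"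
    by simp
qed

lemma
  fixes X :: "('m::finite) moment_dist"
  assumes i: "range i \<subseteq> {1..N}"
  shows integrable_sample_monomial:
      "integrable (sample_law N X) (\<lambda>Y. \<Prod>k\<in>UNIV. Y (i k) $ k)" (is ?int)
    and expectation_sample_monomial:
      "(\<integral>Y. (\<Prod>k\<in>UNIV. Y (i k) $ k) \<partial>sample_law N X) = moment_prod (index_partition i) X" (is ?eq)
proof -
  interpret X: prob_space "measure_of_dist X"
    by (rule prob_space_measure_of_dist)
  interpret product_sigma_finite "\<lambda>_. measure_of_dist X"
    by unfold_locales
  \<comment> \<open>Grouping the coordinates by row gives an integrand that factors along the
    product measure. The product runs over all \<open>N\<close> rows, including those that
    \<open>i\<close> misses.\<close>
  have rows: "(\<Prod>k\<in>UNIV. Y (i k) $ k) = (\<Prod>v\<in>{1..N}. \<Prod>k\<in>i -` {v}. Y v $ k)"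
    for Y :: "nat \<Rightarrow> real ^ 'm"
  proof -
    have "(\<Prod>k\<in>UNIV. Y (i k) $ k) = (\<Prod>v\<in>{1..N}. \<Prod>k | k \<in> UNIV \<and> i k = v. Y (i k) $ k)"
      using i by (intro prod.group[symmetric]) auto
    then show ?thesis
      by (simp add: vimage_def)
  qed
  show ?int
    unfolding rows sample_law_def
    by (rule product_integrable_prod) (auto intro: integrable_prod_components)
  have "(\<integral>Y. (\<Prod>k\<in>UNIV. Y (i k) $ k) \<partial>sample_law N X) = (\<Prod>v\<in>{1..N}. mixed_moment (i -` {v}) X)"
    unfolding rows sample_law_def mixed_moment_def
    by (rule product_integral_prod) (auto intro: integrable_prod_components)
  also have "\<dots> = (\<Prod>v\<in>range i. mixed_moment (i -` {v}) X)"
  proof (rule prod.mono_neutral_right)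
    \<comment> \<open>A missed row contributes the empty monomial, whose integral is the total mass
      1.\<close>
    show "\<forall>v\<in>{1..N} - range i. mixed_moment (i -` {v}) X = 1"
    proof
      fix v assume "v \<in> {1..N} - range i"
      then have "i -` {v} = {}"
        by auto
      then show "mixed_moment (i -` {v}) X = 1"
        by (simp add: mixed_moment_def X.prob_space)
    qed
  qed (use i in auto)
  also have "\<dots> = moment_prod (index_partition i) X"
    unfolding moment_prod_def index_partition_eq_image
    \<comment> \<open>Distinct attained values have distinct fibres, so no part is counted
      twice.\<close>
    by (subst prod.reindex) (auto simp: inj_on_def)
  finally show ?eq .
qed

text \<open>By \<open>moment_prod_empirical\<close> the integrand is a finite sum of integrable
  monomials divided by a constant.\<close>

lemma moment_prod_in_resample_domain:
  assumes "N \<ge> 1" "\<sigma> \<in> partitions"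
  shows "moment_prod \<sigma> \<in> resample_domain N"
  using assms unfolding resample_domain_def partitions_def
  by (auto simp: moment_prod_empirical I_ge_def
      intro!: integrable_divide Bochner_Integration.integrable_sum integrable_sample_monomial)

lemma sum_fun_apply: "(\<Sum>a\<in>A. f a) x = (\<Sum>a\<in>A. f a x)"
  by (induction A rule: infinite_finite_induct) auto

section \<open>The action on moment products\<close>

lemma resample_moment_prod:
  fixes \<sigma> :: "('m::finite) set set"
  assumes N: "N \<ge> 1" and "\<sigma> \<in> partitions"
  shows "resample N (moment_prod \<sigma>) =
    (\<Sum>\<pi> | \<pi> \<in> partitions \<and> refines UNIV \<sigma> \<pi>.
      (real (card (I_eq N \<pi>)) / real (card (I_ge N \<sigma>))) *\<^sub>R moment_prod \<pi>)"
proof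
  fix X :: "'m moment_dist"
  let ?above = "{\<pi>. \<pi> \<in> partitions \<and> refines UNIV \<sigma> \<pi>}"
  have \<sigma>: "partition_on UNIV \<sigma>"
    using assms by (simp add: partitions_def)
  have range_I_ge: "range i \<subseteq> {1..N}" if "i \<in> I_ge N \<sigma>" for i
    using that by (simp add: I_ge_def)
  have "resample N (moment_prod \<sigma>) X =
    (\<integral>Y. (\<Sum>i\<in>I_ge N \<sigma>. \<Prod>k\<in>UNIV. Y (i k) $ k) \<partial>sample_law N X) / card (I_ge N \<sigma>)"
    by (simp add: resample_def moment_prod_empirical[OF N \<sigma>])
  also have "(\<integral>Y. (\<Sum>i\<in>I_ge N \<sigma>. \<Prod>k\<in>UNIV. Y (i k) $ k) \<partial>sample_law N X) =
    (\<Sum>i\<in>I_ge N \<sigma>. moment_prod (index_partition i) X)"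
    by (subst Bochner_Integration.integral_sum)
      (auto intro!: sum.cong integrable_sample_monomial range_I_ge expectation_sample_monomial)
  \<comment> \<open>Multiindices are sorted by the partition that they induce, which lies above
    \<sigma> by the definition of \<open>I_ge\<close>.\<close>
  also have "\<dots> = (\<Sum>\<pi>\<in>?above.
      \<Sum>i | i \<in> I_ge N \<sigma> \<and> index_partition i = \<pi>. moment_prod (index_partition i) X)"
    by (rule sum.group[symmetric])
      (use finite_I_ge in \<open>auto simp: I_ge_def partitions_def partition_on_index_partition\<close>)
  also have "\<dots> = (\<Sum>\<pi>\<in>?above. card (I_eq N \<pi>) * moment_prod \<pi> X)"
  proof (intro sum.cong refl)
    fix \<pi> assume "\<pi> \<in> ?above"
    \<comment> \<open>As \<pi> is above \<sigma>, inducing \<pi> already forces membership in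
      \<open>I_ge N \<sigma>\<close>, so the whole of \<open>I_eq N \<pi>\<close> is met.\<close>
    then have "{i. i \<in> I_ge N \<sigma> \<and> index_partition i = \<pi>} = I_eq N \<pi>"
      by (auto simp: I_ge_def I_eq_def)
    moreover have "(\<Sum>i\<in>I_eq N \<pi>. moment_prod (index_partition i) X) =
        (\<Sum>i\<in>I_eq N \<pi>. moment_prod \<pi> X)"
      by (intro sum.cong) (auto simp: I_eq_def)
    ultimately show "(\<Sum>i | i \<in> I_ge N \<sigma> \<and> index_partition i = \<pi>.
        moment_prod (index_partition i) X) = card (I_eq N \<pi>) * moment_prod \<pi> X"
      by simp
  qed
  finally show "resample N (moment_prod \<sigma>) X =
    (\<Sum>\<pi>\<in>?above. (real (card (I_eq N \<pi>)) / real (card (I_ge N \<sigma>))) *\<^sub>R moment_prod \<pi>) X"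
    by (simp add: sum_fun_apply scaleR_fun_def sum_divide_distrib)
qed

text \<open>The zero entries of the matrix extend the sum to a range independent of \<sigma>, so
  that the sums over \<sigma> and \<pi> can later be swapped.\<close>

lemma resample_moment_prod_eq_matrix:
  fixes \<sigma> :: "('m::finite) set set"
  assumes "N \<ge> 1" "\<sigma> \<in> partitions"
  shows "resample N (moment_prod \<sigma>) =
    (\<Sum>\<pi>\<in>partitions. resample_matrix N \<pi> \<sigma> *\<^sub>R moment_prod \<pi>)"
  unfolding resample_moment_prod[OF assms] resample_matrix_def
  by (rule sum.mono_neutral_cong_left) auto

section \<open>Linear extension to moment polynomials\<close>

lemma subspace_resample_domain:
  "subspace (resample_domain N :: (('m::finite) moment_dist \<Rightarrow> real) set)"
  by (rule subspaceI) (auto simp: resample_domain_def scaleR_fun_def)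

text \<open>Integrability of every summand lets the expectation pass through the sum; with the
  default value 0 of the Bochner integral, additivity can fail outside the domain.\<close>

lemma resample_sum_scaleR:
  assumes "\<And>a. a \<in> A \<Longrightarrow> F a \<in> resample_domain N"
  shows "resample N (\<Sum>a\<in>A. c a *\<^sub>R F a) = (\<Sum>a\<in>A. c a *\<^sub>R resample N (F a))"
proof
  fix X
  have "integrable (sample_law N X) (\<lambda>Y. F a (empirical N Y))" if "a \<in> A" for a
    using assms[OF that] by (simp add: resample_domain_def)
  then show "resample N (\<Sum>a\<in>A. c a *\<^sub>R F a) X = (\<Sum>a\<in>A. c a *\<^sub>R resample N (F a)) X"
    by (simp add: resample_def sum_fun_apply scaleR_fun_def Bochner_Integration.integral_sum)
qed

lemma resample_moment_polynomial:
  fixes f :: "('m::finite) set set \<Rightarrow> real"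
  assumes N: "N \<ge> 1"
  shows "resample N (\<Sum>\<sigma>\<in>partitions. f \<sigma> *\<^sub>R moment_prod \<sigma>) =
    (\<Sum>\<pi>\<in>partitions. mat_vec (resample_matrix N) f \<pi> *\<^sub>R moment_prod \<pi>)"
proof -
  have "resample N (\<Sum>\<sigma>\<in>partitions. f \<sigma> *\<^sub>R moment_prod \<sigma>) =
    (\<Sum>\<sigma>\<in>partitions. f \<sigma> *\<^sub>R resample N (moment_prod \<sigma>))"
    by (rule resample_sum_scaleR) (rule moment_prod_in_resample_domain[OF N])
  also have "\<dots> = (\<Sum>\<sigma>\<in>partitions. \<Sum>\<pi>\<in>partitions.
      (resample_matrix N \<pi> \<sigma> * f \<sigma>) *\<^sub>R moment_prod \<pi>)"
    by (intro sum.cong refl)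
      (simp add: resample_moment_prod_eq_matrix[OF N] scaleR_sum_right mult.commute)
  also have "\<dots> = (\<Sum>\<pi>\<in>partitions. mat_vec (resample_matrix N) f \<pi> *\<^sub>R moment_prod \<pi>)"
    unfolding mat_vec_def scaleR_sum_left by (rule sum.swap)
  finally show ?thesis .
qed

text \<open>Indexing the coefficients by \<open>A\<close>, rather than by its image, matches the
  moment polynomials of \<open>resample_moment_polynomial\<close>, even if \<open>g\<close>
  identifies elements.\<close>

lemma span_image_finite_obtain:
  assumes "finite A" "F \<in> span (g ` A)"
  obtains c where "F = (\<Sum>a\<in>A. c a *\<^sub>R g a)"
proof -
  have "F \<in> range (\<lambda>c. \<Sum>a\<in>A. c a *\<^sub>R g a)"
    using assms(2)
  proof (induction rule: span_induct_alt)
    case base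
    show ?case by (rule range_eqI[where x = "\<lambda>_. 0"]) simp
  next
    case (step r x y)
    then obtain a c where a: "a \<in> A" "x = g a" and c: "y = (\<Sum>a\<in>A. c a *\<^sub>R g a)"
      by auto
    \<comment> \<open>Only the coefficient at one chosen preimage \<open>a\<close> of
      \<open>x\<close> is raised by \<open>r\<close>.\<close>
    have "r *\<^sub>R x + y = (\<Sum>b\<in>A. ((if b = a then r else 0) + c b) *\<^sub>R g b)"
      using a assms(1) by (simp add: c scaleR_add_left sum.distrib if_distrib[of "\<lambda>t. t *\<^sub>R _"] cong: if_cong)
    then show ?case
      by (rule range_eqI[where x = "\<lambda>b. (if b = a then r else 0) + c b"])
  qed
  then show ?thesis using that by auto
qed

theorem theorem4p4:
  fixes N :: nat
  assumes "N \<ge> 1"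
  shows "span (moment_prod ` (partitions :: ('m::finite) set set set)) \<subseteq> resample_domain N \<and>
    resample N ` span (moment_prod ` (partitions :: 'm set set set))
      \<subseteq> span (moment_prod ` partitions) \<and>
    (\<forall>\<sigma> \<in> (partitions :: 'm set set set).
      resample N (moment_prod \<sigma>) =
        (\<Sum>\<pi> | \<pi> \<in> partitions \<and> refines UNIV \<sigma> \<pi>.
          (real (card (I_eq N \<pi>)) / real (card (I_ge N \<sigma>))) *\<^sub>R moment_prod \<pi>)) \<and>
    (\<forall>f :: 'm set set \<Rightarrow> real.
      resample N (\<Sum>\<pi>\<in>partitions. f \<pi> *\<^sub>R moment_prod \<pi>) =
        (\<Sum>\<pi>\<in>partitions. mat_vec (resample_matrix N) f \<pi> *\<^sub>R moment_prod \<pi>))"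
proof (intro conjI ballI allI)
  show "span (moment_prod ` (partitions :: 'm set set set)) \<subseteq> resample_domain N"
    by (rule span_minimal) (auto intro: subspace_resample_domain moment_prod_in_resample_domain[OF assms])
  show "resample N ` span (moment_prod ` (partitions :: 'm set set set))
      \<subseteq> span (moment_prod ` partitions)"
  proof (rule image_subsetI)
    fix F assume "F \<in> span (moment_prod ` (partitions :: 'm set set set))"
    \<comment> \<open>Closure follows because a moment polynomial is sent to another one, with
      coefficients given by the matrix.\<close>
    then obtain f where "F = (\<Sum>\<pi>\<in>(partitions :: 'm set set set). f \<pi> *\<^sub>R moment_prod \<pi>)"
      using span_image_finite_obtain[OF finite] by blast
    then show "resample N F \<in> span (moment_prod ` partitions)"
      by (simp only: resample_moment_polynomial[OF assms])
        (intro span_sum span_scale span_base imageI)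
  qed
qed (fact resample_moment_prod[OF assms] resample_moment_polynomial[OF assms])+

end
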